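(* Let $s\in\mathbb{N}_+$ with $s\ge 2$, and let $f\in C^s[0,1]$ be real-valued. If \[ \lim_{n\to\infty}\|\widehat{B}_n(f)-f\|=0\quad\text{and}\quad\lim_{n\to\infty}\|(\widehat{B}_n(f))^{(s)}-f^{(s)}\|=0, \] then $f^{(i)}(0)=f^{(i)}(1)=0$ for $i=2,\dots,s$.
   Context: $\mathbb{N}_+$ is the set of positive integers. $\|\cdot\|$ is the sup-norm on $[0,1]$. $C^s[0,1]$ is the space of real functions with $s$ continuous derivatives on $[0,1]$ (one-sided at the endpoints). For real $\alpha$, $\langle\alpha\rangle$ denotes the nearest integer to $\alpha$, i.e. an integer at which $\min_{m\in\mathbb{Z}}|\alpha-m|$ is attained. When $\alpha=m+1/2$ with $m\in\mathbb{Z}$, $\langle\alpha\rangle$ is $m$ or $m+1$ according to some tie-breaking rule; the result is asserted for any tie-breaking rule (round half up, down, towards zero, away from zero, to even, to odd, random, or any mixture of these). For $f\in C[0,1]$, $n\in\mathbb{N}_+$, $x\in[0,1]$, \[ \widehat{B}_n(f)(x):=\sum_{k=0}^n\left\langle f\left(\frac kn\right)\binom nk\right\rangle x^k(1-x)^{n-k}. \] *)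

theory Defs
  imports "HOL-Analysis.Analysis"
begin

(* The derivative is taken within [0,1], hence is one-sided at the endpoints and depends only on
   the values on [0,1]; it is meaningful only where the function is differentiable within [0,1]. *)
definition deriv01 :: "nat \<Rightarrow> (real \<Rightarrow> real) \<Rightarrow> real \<Rightarrow> real" where
  "deriv01 i f = ((\<lambda>g x. vector_derivative g (at x within {0..1})) ^^ i) f"

definition C01 :: "nat \<Rightarrow> (real \<Rightarrow> real) set" where
  "C01 s = {f. (\<forall>i<s. deriv01 i f differentiable_on {0..1}) \<and> continuous_on {0..1} (deriv01 s f)}"

(* The real supremum is meaningful only for functions bounded on [0,1],
   in particular for continuous ones. *)
definition supnorm01 :: "(real \<Rightarrow> real) \<Rightarrow> real" where
  "supnorm01 g = (SUP x\<in>{0..1}. \<bar>g x\<bar>)"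

definition nearest_int :: "real \<Rightarrow> int \<Rightarrow> bool" where
  "nearest_int a m \<longleftrightarrow> is_arg_min (\<lambda>j::int. \<bar>a - of_int j\<bar>) (\<lambda>_. True) m"

(* A rounding chooses a nearest integer for every real number. The choice may also depend on the
   degree n and the index k, which covers random tie-breaking and mixtures of several rules. *)
definition tie_breaking_rule :: "(nat \<Rightarrow> nat \<Rightarrow> real \<Rightarrow> int) \<Rightarrow> bool" where
  "tie_breaking_rule rnd \<longleftrightarrow> (\<forall>n k a. nearest_int a (rnd n k a))"

definition int_bernstein ::
  "(nat \<Rightarrow> nat \<Rightarrow> real \<Rightarrow> int) \<Rightarrow> nat \<Rightarrow> (real \<Rightarrow> real) \<Rightarrow> real \<Rightarrow> real" where
  "int_bernstein rnd n f x =
     (\<Sum>k=0..n. of_int (rnd n k (f (real k / real n) * real (n choose k))) * x ^ k * (1 - x) ^ (n - k))"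

end

theory Submission
  imports Defs
begin

text \<open>
  Let \<open>P\<^sub>n\<close> be the integer Bernstein polynomial of \<open>f\<close> and \<open>a\<^sub>i = f\<^bsup>(i)\<^esup>(0) / i!\<close>.
  Three observations about the endpoint 0 decide the matter.

  \<^item> Convergence of \<open>P\<^sub>n\<close> and of its \<open>s\<close>-th derivative forces convergence of all derivatives
  in between at 0: by Taylor's formula the Taylor polynomials of \<open>P\<^sub>n - f\<close> at 0 tend to 0 on
  \<open>[0,1]\<close>, hence so do their coefficients (\<open>derivatives_at_0_tendsto_0\<close>).  The coefficients of
  \<open>P\<^sub>n\<close> are integers, so for \<open>i \<le> s\<close> the number \<open>a\<^sub>i\<close> is an integer and the \<open>i\<close>-th coefficient
  of \<open>P\<^sub>n\<close> is eventually equal to it.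

  \<^item> The Bernstein operator reproduces \<open>L(x) = a\<^sub>0 + a\<^sub>1 x\<close>, so \<open>P\<^sub>n - L\<close> has Bernstein coefficients
  \<open>d\<^sub>i\<close> within 1/2 of \<open>(f - L)(i/n) \<cdot> (n choose i)\<close>.  Let \<open>2 \<le> k \<le> s\<close> and suppose that
  \<open>a\<^sub>2, \<dots>, a\<^sub>k\<^sub>-\<^sub>1\<close> vanish.  Then \<open>P\<^sub>n - L\<close> eventually vanishes to order \<open>k\<close> at 0, and since
  \<open>x\<^sup>i (1 - x)\<^bsup>n-i\<^esup>\<close> starts with \<open>x\<^sup>i\<close>, this gives \<open>d\<^sub>k = a\<^sub>k\<close>
  (\<open>bernstein_form_vanishing_order\<close>, \<open>coeff_bernstein_form_lowest\<close>).

  \<^item> On the other hand \<open>(f - L)(x) = a\<^sub>k x\<^sup>k + o(x\<^sup>k)\<close> and \<open>n choose k\<close> is asymptotic to \<open>n\<^sup>k / k!\<close>,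
  so \<open>(f - L)(k/n) \<cdot> (n choose k)\<close> tends to \<open>a\<^sub>k k\<^sup>k / k!\<close>.  Hence
  \<open>\<bar>a\<^sub>k\<bar> (k\<^sup>k / k! - 1) \<le> 1/2\<close>.  As \<open>k\<^sup>k \<ge> 2 k!\<close> for \<open>k \<ge> 2\<close>, the integer \<open>a\<^sub>k\<close> is 0.

  The endpoint 1 is reduced to 0 by the substitution \<open>x \<mapsto> 1 - x\<close>, which reverses the sequence of
  Bernstein coefficients.  The rounding enters through the bound 1/2 on the distance between a
  number and a nearest integer, and this bound is the same for every tie-breaking rule.
\<close>

section \<open>Coefficients of polynomials in Bernstein form\<close>

text \<open>The basis polynomials carry no binomial factor, as in the integer Bernstein polynomials: the
  coefficients \<open>c k\<close> are the rounded numbers themselves.\<close>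

definition bernstein_form :: "nat \<Rightarrow> (nat \<Rightarrow> real) \<Rightarrow> real poly" where
  "bernstein_form n c = (\<Sum>k\<le>n. smult (c k) (monom 1 k * [:1, -1:] ^ (n - k)))"

lemma poly_bernstein_form:
  "poly (bernstein_form n c) x = (\<Sum>k\<le>n. c k * x ^ k * (1 - x) ^ (n - k))"
  by (simp add: bernstein_form_def poly_sum poly_monom mult.assoc)

lemma coeff_bernstein_form_lowest:
  assumes "k \<le> n" and "\<forall>i<k. c i = 0"
  shows "coeff (bernstein_form n c) k = c k"
proof -
  have "coeff (bernstein_form n c) k
      = (\<Sum>i\<le>n. c i * (if k < i then 0 else coeff ([:1, -1:] ^ (n - i)) (k - i)))"
    by (simp add: bernstein_form_def coeff_sum coeff_monom_mult cong: if_cong)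
  also have "\<dots> = (\<Sum>i\<le>n. if i = k then c i else 0)"
  proof (rule sum.cong)
    fix i assume "i \<in> {..n}"
    consider "i < k" | "i = k" | "k < i" by linarith
    then show "c i * (if k < i then 0 else coeff ([:1, -1:] ^ (n - i)) (k - i))
        = (if i = k then c i else 0)"
      using assms(2) by cases (auto simp: coeff_0_power)
  qed simp
  also have "\<dots> = c k"
    using assms(1) by simp
  finally show ?thesis .
qed

text \<open>The change from Bernstein to monomial coefficients is triangular with unit diagonal, so
  vanishing to order \<open>k\<close> at 0 can be read off from either family of coefficients.\<close>

lemma bernstein_form_vanishing_order:
  assumes "k \<le> n" and "\<forall>j<k. coeff (bernstein_form n c) j = 0"
  shows "\<forall>j<k. c j = 0"
proof (intro allI impI)
  fix j assume "j < k"
  then show "c j = 0"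
  proof (induction j rule: less_induct)
    case (less j)
    then have "coeff (bernstein_form n c) j = c j"
      using assms(1) by (intro coeff_bernstein_form_lowest) auto
    with less.prems assms(2) show ?case by simp
  qed
qed

lemma bernstein_form_linear:
  assumes "n > 0"
  shows "bernstein_form n (\<lambda>k. (a + b * (real k / real n)) * real (n choose k)) = [:a, b:]"
proof -
  have "poly (bernstein_form n (\<lambda>k. (a + b * (real k / real n)) * real (n choose k))) x
      = a + b * x" for x
  proof -
    have "poly (bernstein_form n (\<lambda>k. (a + b * (real k / real n)) * real (n choose k))) x
        = (\<Sum>k\<le>n. a * Bernstein n k x + (b / real n) * (real k * Bernstein n k x))"
      by (auto simp: poly_bernstein_form Bernstein_def algebra_simps intro!: sum.cong)
    also have "\<dots> = a + (b / real n) * (real n * x)"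
      by (simp only: sum.distrib sum_distrib_left [symmetric] sum_Bernstein sum_k_Bernstein)
    finally show ?thesis
      using assms by simp
  qed
  then show ?thesis
    by (intro poly_eq_poly_eq_iff [THEN iffD1] ext) (simp add: mult.commute)
qed

lemma bernstein_form_diff:
  "bernstein_form n c - bernstein_form n d = bernstein_form n (\<lambda>k. c k - d k)"
  by (simp add: bernstein_form_def sum_subtractf smult_diff_left)

lemma coeff_bernstein_form_Ints:
  assumes "\<And>k. c k \<in> \<int>"
  shows "coeff (bernstein_form n c) i \<in> \<int>"
proof -
  have "coeff ([:1, -1:] ^ m :: real poly) j \<in> \<int>" for m j
    by (induction m arbitrary: j) (auto simp: coeff_pCons split: nat.split)
  then show ?thesis
    using assms by (auto simp: bernstein_form_def coeff_sum coeff_monom_mult intro!: Ints_sum Ints_mult)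
qed

lemma bernstein_form_reflect:
  "pcompose (bernstein_form n c) [:1, -1:] = bernstein_form n (\<lambda>k. c (n - k))"
proof -
  have "poly (pcompose (bernstein_form n c) [:1, -1:]) x
      = poly (bernstein_form n (\<lambda>k. c (n - k))) x" for x
  proof -
    have "poly (pcompose (bernstein_form n c) [:1, -1:]) x
        = (\<Sum>k\<le>n. c k * (1 - x) ^ k * x ^ (n - k))"
      by (simp add: poly_pcompose poly_bernstein_form)
    also have "\<dots> = (\<Sum>k\<le>n. c (n - k) * (1 - x) ^ (n - k) * x ^ k)"
      by (rule sum.reindex_bij_witness [of _ "\<lambda>k. n - k" "\<lambda>k. n - k"]) auto
    finally show ?thesis
      by (simp add: poly_bernstein_form mult_ac)
  qed
  then show ?thesis
    by (intro poly_eq_poly_eq_iff [THEN iffD1] ext)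
qed

lemma higher_pderiv_reflect:
  "(pderiv ^^ i) (pcompose p [:1, -1:]) = smult ((-1) ^ i) (pcompose ((pderiv ^^ i) p) [:1, -1:])"
  for p :: "real poly"
  by (induction i) (simp_all add: pderiv_smult pderiv_pcompose pderiv_pCons)

section \<open>Convergence of Taylor coefficients at an endpoint\<close>

text \<open>On polynomials of bounded degree pointwise convergence and convergence of coefficients agree.
  The induction on the degree rests on the dilation \<open>x \<mapsto> x / 2\<close>: the combination
  \<open>p(x) - 2\<^sup>d p(x/2)\<close> has no term of degree \<open>d\<close> and multiplies each lower coefficient by a
  nonzero constant.\<close>

lemma polynomial_coefficients_tendsto_0:
  fixes c :: "nat \<Rightarrow> nat \<Rightarrow> real"
  assumes "\<And>x. x \<in> {0..1} \<Longrightarrow> (\<lambda>n. \<Sum>i<d. c n i * x ^ i) \<longlonglongrightarrow> 0" and "i < d"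
  shows "(\<lambda>n. c n i) \<longlonglongrightarrow> 0"
  using assms
proof (induction d arbitrary: c i)
  case 0
  then show ?case by simp
next
  case (Suc d)
  have lower: "(\<lambda>n. c n j) \<longlonglongrightarrow> 0" if "j < d" for j
  proof -
    have "(\<lambda>n. c n j * (1 - 2 ^ d / 2 ^ j)) \<longlonglongrightarrow> 0"
    proof (rule Suc.IH [OF _ that])
      fix x :: real assume x: "x \<in> {0..1}"
      have "(\<lambda>n. (\<Sum>i<Suc d. c n i * x ^ i) - 2 ^ d * (\<Sum>i<Suc d. c n i * (x / 2) ^ i))
          \<longlonglongrightarrow> 0 - 2 ^ d * 0"
        using x by (intro tendsto_diff tendsto_mult tendsto_const Suc.prems(1)) auto
      moreover have "(\<Sum>i<Suc d. c n i * x ^ i) - 2 ^ d * (\<Sum>i<Suc d. c n i * (x / 2) ^ i)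
          = (\<Sum>i<d. c n i * (1 - 2 ^ d / 2 ^ i) * x ^ i)" for n
        by (simp add: sum_distrib_left sum_subtractf [symmetric] power_divide algebra_simps)
      ultimately show "(\<lambda>n. \<Sum>i<d. c n i * (1 - 2 ^ d / 2 ^ i) * x ^ i) \<longlonglongrightarrow> 0"
        by simp
    qed
    moreover have "1 - 2 ^ d / 2 ^ j \<noteq> (0::real)"
      using that by simp
    ultimately show ?thesis
      using tendsto_mult_right_iff by (metis mult_zero_left)
  qed
  show ?case
  proof (cases "i < d")
    case False
    have "(\<lambda>n. (\<Sum>j<Suc d. c n j * 1 ^ j) - (\<Sum>j<d. c n j)) \<longlonglongrightarrow> 0 - (\<Sum>j<d. 0)"
      by (intro tendsto_diff Suc.prems(1) tendsto_sum lower) auto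
    moreover have "i = d"
      using False Suc.prems(2) by simp
    ultimately show ?thesis by simp
  qed (use lower in blast)
qed

text \<open>Control of a function and of its \<open>s\<close>-th derivative controls the derivatives in between:
  the remainder in Taylor's formula is bounded by the \<open>s\<close>-th derivative, so the Taylor polynomial
  of degree less than \<open>s\<close> tends to 0 together with the function.\<close>

lemma derivatives_at_0_tendsto_0:
  fixes G :: "nat \<Rightarrow> nat \<Rightarrow> real \<Rightarrow> real"
  assumes D: "\<And>n i x. i < s \<Longrightarrow> x \<in> {0..1} \<Longrightarrow>
      (G n i has_real_derivative G n (Suc i) x) (at x within {0..1})"
    and lim0: "\<And>x. x \<in> {0..1} \<Longrightarrow> (\<lambda>n. G n 0 x) \<longlonglongrightarrow> 0"
    and lims: "uniform_limit {0..1} (\<lambda>n. G n s) (\<lambda>_. 0) sequentially"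
    and i: "i \<le> s"
  shows "(\<lambda>n. G n i 0) \<longlonglongrightarrow> 0"
proof (cases "i = s")
  case True
  then show ?thesis
    using tendsto_uniform_limitI [OF lims, of 0] by simp
next
  case False
  have "(\<lambda>n. \<Sum>j<s. G n j 0 / fact j * x ^ j) \<longlonglongrightarrow> 0" if x: "x \<in> {0..1}" for x
  proof -
    have "(\<lambda>n. G n 0 x - (\<Sum>j<s. G n j 0 / fact j * x ^ j)) \<longlonglongrightarrow> 0"
    proof (rule tendstoI)
      fix e :: real assume e: "e > 0"
      have "\<forall>\<^sub>F n in sequentially. \<forall>y\<in>{0..1}. dist (G n s y) 0 < e / 2"
        using uniform_limitD [OF lims, of "e / 2"] e by simp
      then show "\<forall>\<^sub>F n in sequentially. dist (G n 0 x - (\<Sum>j<s. G n j 0 / fact j * x ^ j)) 0 < e"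
      proof eventually_elim
        case (elim n)
        have s: "Suc (s - 1) = s"
          using False i by simp
        have "norm (G n 0 x - (\<Sum>j\<le>s - 1. G n j 0 * (x - 0) ^ j / fact j))
            \<le> e / 2 * norm (x - 0) ^ Suc (s - 1) / fact (s - 1)"
        proof (rule field_Taylor [where S = "{0..1}"])
          show "(G n j has_real_derivative G n (Suc j) y) (at y within {0..1})"
            if "y \<in> {0..1}" "j \<le> s - 1" for j y
            using that s by (intro D) auto
          show "norm (G n (Suc (s - 1)) y) \<le> e / 2" if "y \<in> {0..1}" for y
            using elim that unfolding s by (force simp: less_imp_le)
        qed (use x in auto)
        also have "\<dots> \<le> e / 2 * 1 / 1"
          using x e by (intro frac_le mult_left_mono) (auto simp: power_le_one fact_ge_1 simp del: power_Suc)
        also have "{..s - 1} = {..<s}"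
          using s by auto
        finally show ?case
          using e by (simp add: dist_norm mult.commute)
      qed
    qed
    from tendsto_diff [OF lim0 [OF x] this] show ?thesis by simp
  qed
  then have "(\<lambda>n. G n i 0 / fact i) \<longlonglongrightarrow> 0"
    using False i by (intro polynomial_coefficients_tendsto_0 [where c = "\<lambda>n j. G n j 0 / fact j" and d = s]) auto
  then have "(\<lambda>n. G n i 0 / fact i * fact i) \<longlonglongrightarrow> 0"
    by (rule tendsto_mult_left_zero)
  then show ?thesis by simp
qed

text \<open>Peano's form of the remainder, one-sided and with continuity of the last derivative in place
  of a further derivative.\<close>

lemma taylor_peano_at_0:
  fixes F :: "nat \<Rightarrow> real \<Rightarrow> real"
  assumes D: "\<And>i x. i < k \<Longrightarrow> x \<in> {0..1} \<Longrightarrow>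
      (F i has_real_derivative F (Suc i) x) (at x within {0..1})"
    and cont: "continuous_on {0..1} (F k)" and "k > 0"
  shows "((\<lambda>x. (F 0 x - (\<Sum>i<k. F i 0 * x ^ i / fact i)) / x ^ k) \<longlongrightarrow> F k 0 / fact k) (at_right 0)"
proof (rule tendstoI)
  fix e :: real assume e: "e > 0"
  obtain d where d: "d > 0" "\<And>x. x \<in> {0..1} \<Longrightarrow> dist x 0 < d \<Longrightarrow> dist (F k x) (F k 0) < e / 2"
    using cont e unfolding continuous_on_iff
    by (metis atLeastAtMost_iff half_gt_zero order_refl zero_le_one)
  have "\<forall>\<^sub>F h in at_right 0. h \<in> {0<..<min d 1}"
    using d(1) by (intro eventually_at_right_real) auto
  then show "\<forall>\<^sub>F h in at_right 0.
      dist ((F 0 h - (\<Sum>i<k. F i 0 * h ^ i / fact i)) / h ^ k) (F k 0 / fact k) < e"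
  proof eventually_elim
    case (elim h)
    \<comment> \<open>Subtracting \<open>F k 0 * x ^ k / fact k\<close> leaves the lower derivatives at 0 unchanged and makes
      the \<open>k\<close>-th derivative small near 0, so that Lagrange's bound suffices.\<close>
    define H where "H = (\<lambda>i x. F i x - F k 0 * (x ^ (k - i) / fact (k - i)))"
    have k: "Suc (k - 1) = k"
      using \<open>k > 0\<close> by simp
    have "norm (H 0 h - (\<Sum>i\<le>k - 1. H i 0 * (h - 0) ^ i / fact i))
        \<le> e / 2 * norm (h - 0) ^ Suc (k - 1) / fact (k - 1)"
    proof (rule field_Taylor [where S = "{0..h}"])
      show "(H i has_real_derivative H (Suc i) x) (at x within {0..h})"
        if x: "x \<in> {0..h}" and i: "i \<le> k - 1" for i x
      proof -
        have *: "k - i = Suc (k - Suc i)"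
          using i k by simp
        have "(F i has_real_derivative F (Suc i) x) (at x within {0..h})"
          using elim x i k by (intro DERIV_subset [OF D]) auto
        moreover have "((\<lambda>x::real. x ^ Suc m / fact (Suc m)) has_real_derivative x ^ m / fact m)
            (at x within {0..h})" for m
          by (auto intro!: derivative_eq_intros simp: field_simps simp del: power_Suc of_nat_Suc)
        ultimately show ?thesis
          unfolding H_def * by (intro DERIV_diff DERIV_cmult)
      qed
      show "norm (H (Suc (k - 1)) x) \<le> e / 2" if "x \<in> {0..h}" for x
        using d(2) [of x] that elim unfolding k H_def by (auto simp: dist_norm)
    qed (use elim in auto)
    also have "\<dots> \<le> e / 2 * h ^ k / 1"
      using elim e k by (intro frac_le) (auto simp: fact_ge_1)
    also have "(\<Sum>i\<le>k - 1. H i 0 * (h - 0) ^ i / fact i) = (\<Sum>i<k. F i 0 * h ^ i / fact i)"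
      using k by (intro sum.cong) (auto simp: H_def)
    finally have bound: "\<bar>F 0 h - F k 0 * (h ^ k / fact k) - (\<Sum>i<k. F i 0 * h ^ i / fact i)\<bar> \<le> e / 2 * h ^ k"
      by (simp add: H_def)
    have "(F 0 h - (\<Sum>i<k. F i 0 * h ^ i / fact i)) / h ^ k - F k 0 / fact k
        = (F 0 h - F k 0 * (h ^ k / fact k) - (\<Sum>i<k. F i 0 * h ^ i / fact i)) / h ^ k"
      using elim by (simp add: field_simps)
    also have "\<bar>\<dots>\<bar> \<le> e / 2"
      using bound elim by (simp add: divide_le_eq)
    finally show ?case
      using e by (simp add: dist_norm)
  qed
qed

section \<open>Forced vanishing at the left endpoint\<close>

lemma integer_sequence_limit:
  fixes c :: "nat \<Rightarrow> real"
  assumes "c \<longlonglongrightarrow> L" and "\<And>n. c n \<in> \<int>"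
  shows "L \<in> \<int>" and "\<forall>\<^sub>F n in sequentially. c n = L"
proof -
  show L: "L \<in> \<int>"
    using assms by (intro Lim_in_closed_set [OF closed_Ints, of c sequentially]) auto
  have "\<forall>\<^sub>F n in sequentially. dist (c n) L < 1"
    using assms(1) by (rule tendstoD) simp
  then show "\<forall>\<^sub>F n in sequentially. c n = L"
    by eventually_elim (use assms(2) L in \<open>simp add: dist_norm Ints_eq_abs_less1\<close>)
qed

lemma choose_over_power_tendsto:
  "(\<lambda>n. real (n choose k) / real n ^ k) \<longlonglongrightarrow> 1 / fact k"
proof -
  have "(\<lambda>n. (\<Prod>i<k. 1 - real i / real n) / fact k) \<longlonglongrightarrow> (\<Prod>i<k. 1 - 0) / fact k"
    by (intro tendsto_intros lim_const_over_n) auto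
  moreover have "\<forall>\<^sub>F n in sequentially.
      (\<Prod>i<k. 1 - real i / real n) / fact k = real (n choose k) / real n ^ k"
    using eventually_gt_at_top [of 0]
  proof eventually_elim
    case (elim n)
    have "real (n choose k) = (\<Prod>i<k. real n - real i) / fact k"
      by (simp add: binomial_gbinomial gbinomial_prod_rev lessThan_atLeast0)
    moreover have "(\<Prod>i<k. 1 - real i / real n) = (\<Prod>i<k. (real n - real i) / real n)"
      using elim by (intro prod.cong) (auto simp: field_simps)
    ultimately show ?case
      by (simp add: prod_dividef)
  qed
  ultimately show ?thesis
    by (simp add: tendsto_cong)
qed

lemma double_fact_le_power:
  assumes "k \<ge> 2"
  shows "2 * fact k \<le> (of_nat (k ^ k) :: real)"
  using assms
proof (induction k rule: dec_induct)
  case base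
  then show ?case by (simp add: numeral_2_eq_2)
next
  case (step k)
  have "2 * fact (Suc k) = real (Suc k) * (2 * fact k)"
    by simp
  also have "\<dots> \<le> real (Suc k) * real (k ^ k)"
    using step.IH by (intro mult_left_mono) auto
  also have "\<dots> \<le> real (Suc k) * real (Suc k ^ k)"
    by (intro mult_left_mono of_nat_mono power_mono) auto
  finally show ?case by (simp only: power_Suc of_nat_mult)
qed

text \<open>The derivatives form a family \<open>F\<close> given in advance, and the integers \<open>b n k\<close> are arbitrary
  within distance 1/2 of the unrounded coefficients.  In this form the hypotheses are invariant
  under \<open>x \<mapsto> 1 - x\<close>, which takes care of the other endpoint.\<close>

lemma vanishing_derivatives_at_0:
  fixes F :: "nat \<Rightarrow> real \<Rightarrow> real" and b :: "nat \<Rightarrow> nat \<Rightarrow> int"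
  defines "P \<equiv> \<lambda>n. bernstein_form n (\<lambda>k. of_int (b n k))"
  assumes D: "\<And>i x. i < s \<Longrightarrow> x \<in> {0..1} \<Longrightarrow>
      (F i has_real_derivative F (Suc i) x) (at x within {0..1})"
    and cont: "continuous_on {0..1} (F s)"
    and near: "\<And>n k. n > 0 \<Longrightarrow> k \<le> n \<Longrightarrow>
      \<bar>of_int (b n k) - F 0 (real k / real n) * real (n choose k)\<bar> \<le> 1 / 2"
    and lim0: "\<And>x. x \<in> {0..1} \<Longrightarrow> (\<lambda>n. poly (P n) x) \<longlonglongrightarrow> F 0 x"
    and lims: "uniform_limit {0..1} (\<lambda>n. poly ((pderiv ^^ s) (P n))) (F s) sequentially"
    and k: "2 \<le> k" "k \<le> s"
  shows "F k 0 = 0"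
proof -
  define a where "a = (\<lambda>i. F i 0 / fact i)"
  have coeff_lim: "(\<lambda>n. coeff (P n) i) \<longlonglongrightarrow> a i" if "i \<le> s" for i
  proof -
    define G where "G = (\<lambda>n i x. poly ((pderiv ^^ i) (P n)) x - F i x)"
    have "(\<lambda>n. G n i 0) \<longlonglongrightarrow> 0"
    proof (rule derivatives_at_0_tendsto_0 [OF _ _ _ that])
      show "(G n i has_real_derivative G n (Suc i) x) (at x within {0..1})"
        if "i < s" "x \<in> {0..1}" for n i x
        unfolding G_def using D [OF that]
        by (intro DERIV_diff) (auto intro: DERIV_subset [OF poly_DERIV])
      show "(\<lambda>n. G n 0 x) \<longlonglongrightarrow> 0" if "x \<in> {0..1}" for x
        using lim0 [OF that] by (simp add: G_def LIM_zero)
      show "uniform_limit {0..1} (\<lambda>n. G n s) (\<lambda>_. 0) sequentially"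
        using lims by (simp add: G_def uniform_limit_iff dist_norm)
    qed
    then have "(\<lambda>n. (G n i 0 + F i 0) / fact i) \<longlonglongrightarrow> (0 + F i 0) / fact i"
      by (intro tendsto_intros) auto
    moreover have "(G n i 0 + F i 0) / fact i = coeff (P n) i" for n
      by (simp add: G_def poly_0_coeff_0 coeff_higher_pderiv pochhammer_fact [symmetric])
    ultimately show ?thesis
      by (simp add: a_def)
  qed
  have P_Ints: "coeff (P n) i \<in> \<int>" for n i
    unfolding P_def by (rule coeff_bernstein_form_Ints) simp
  have coeff_eq: "\<forall>\<^sub>F n in sequentially. coeff (P n) i = a i" and a_Ints: "a i \<in> \<int>" if "i \<le> s" for i
    using integer_sequence_limit [OF coeff_lim [OF that] P_Ints] by auto
  from k have "a k = 0"
  proof (induction k rule: less_induct)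
    case (less k)
    define L where "L = [:a 0, a 1:]"
    define q where "q = (\<lambda>n. real k / real n)"
    have L_coeff: "coeff L j = a j" if "j < k" for j
    proof -
      consider "j = 0" | "j = 1" | "2 \<le> j" by linarith
      then show ?thesis
        using that less.IH [of j] less.prems
        by cases (auto simp: L_def coeff_pCons split: nat.split)
    qed
    have k_coeff: "coeff L k = 0"
      using less.prems by (auto simp: L_def coeff_pCons split: nat.split)
    have "\<forall>\<^sub>F n in sequentially. \<forall>j\<le>k. coeff (P n) j = a j"
    proof -
      have "\<forall>\<^sub>F n in sequentially. \<forall>j\<in>{..k}. coeff (P n) j = a j"
        using less.prems coeff_eq by (intro eventually_ball_finite) auto
      then show ?thesis
        by (simp add: Ball_def)
    qed
    moreover have "\<forall>\<^sub>F n in sequentially. n > 0 \<and> n \<ge> k"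
      by (intro eventually_conj eventually_gt_at_top eventually_ge_at_top)
    ultimately have half: "\<forall>\<^sub>F n in sequentially.
        \<bar>a k - (F 0 (q n) - poly L (q n)) * real (n choose k)\<bar> \<le> 1 / 2"
    proof eventually_elim
      case (elim n)
      \<comment> \<open>The Bernstein coefficients of \<open>P n - L\<close>: the operator reproduces \<open>L\<close>, so only its values
        at the nodes have to be subtracted.\<close>
      define d where "d = (\<lambda>i. of_int (b n i) - (a 0 + a 1 * (real i / real n)) * real (n choose i))"
      have d: "bernstein_form n d = P n - L"
        using elim bernstein_form_linear [of n "a 0" "a 1"]
        unfolding d_def P_def L_def bernstein_form_diff [symmetric] by simp
      have "\<forall>j<k. coeff (bernstein_form n d) j = 0"
        unfolding d using elim(1) L_coeff by simp
      then have "\<forall>i<k. d i = 0"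
        using elim(2) bernstein_form_vanishing_order by blast
      then have "d k = coeff (P n - L) k"
        using elim(2) coeff_bernstein_form_lowest [of k n d] unfolding d by simp
      also have "\<dots> = a k"
        using elim(1) k_coeff by simp
      finally have "d k = a k" .
      with near [of n k] elim show ?case
        by (simp add: d_def L_def q_def algebra_simps)
    qed
    \<comment> \<open>By the induction hypothesis only the linear part of the Taylor polynomial survives.\<close>
    have taylor: "(\<Sum>i<k. F i 0 * x ^ i / fact i) = poly L x" for x
    proof -
      have "(\<Sum>i<k. F i 0 * x ^ i / fact i) = (\<Sum>i<k. a i * x ^ i)"
        by (simp add: a_def)
      also have "\<dots> = (\<Sum>i<2. a i * x ^ i)"
        using less.prems by (intro sum.mono_neutral_right) (auto intro: less.IH)
      finally show ?thesis
        by (simp add: L_def numeral_2_eq_2 mult.commute)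
    qed
    have "filterlim q (at_right 0) sequentially"
    proof -
      have "q \<longlonglongrightarrow> 0"
        unfolding q_def by (rule lim_const_over_n)
      moreover have "\<forall>\<^sub>F n in sequentially. q n \<in> {0<..}"
        using eventually_gt_at_top [of 0]
        by eventually_elim (use less.prems in \<open>simp add: q_def\<close>)
      ultimately show ?thesis
        by (auto simp: filterlim_at elim!: eventually_mono)
    qed
    moreover have "continuous_on {0..1} (F k)"
    proof (cases "k = s")
      case False
      then show ?thesis
        unfolding continuous_on_eq_continuous_within
        by (intro ballI DERIV_continuous [OF D]) (use less.prems in auto)
    qed (use cont in simp)
    ultimately have "(\<lambda>n. (F 0 (q n) - (\<Sum>i<k. F i 0 * q n ^ i / fact i)) / q n ^ k) \<longlonglongrightarrow> F k 0 / fact k"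
      using less.prems D by (intro filterlim_compose [OF taylor_peano_at_0]) auto
    then have "(\<lambda>n. (F 0 (q n) - poly L (q n)) / q n ^ k * (real k ^ k * (real (n choose k) / real n ^ k)))
        \<longlonglongrightarrow> a k * (real k ^ k * (1 / fact k))"
      unfolding taylor a_def
      by (intro tendsto_mult [OF _ tendsto_mult] tendsto_const choose_over_power_tendsto)
    moreover have "\<forall>\<^sub>F n in sequentially.
        (F 0 (q n) - poly L (q n)) / q n ^ k * (real k ^ k * (real (n choose k) / real n ^ k))
        = (F 0 (q n) - poly L (q n)) * real (n choose k)"
      using eventually_gt_at_top [of 0]
      by eventually_elim (use less.prems in \<open>simp add: q_def power_divide\<close>)
    ultimately have "(\<lambda>n. (F 0 (q n) - poly L (q n)) * real (n choose k)) \<longlonglongrightarrow> a k * (real k ^ k / fact k)"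
      by (simp add: tendsto_cong)
    then have "(\<lambda>n. \<bar>a k - (F 0 (q n) - poly L (q n)) * real (n choose k)\<bar>)
        \<longlonglongrightarrow> \<bar>a k - a k * (real k ^ k / fact k)\<bar>"
      by (intro tendsto_rabs tendsto_diff tendsto_const)
    then have "\<bar>a k - a k * (real k ^ k / fact k)\<bar> \<le> 1 / 2"
      using half by (rule tendsto_upperbound) simp
    also have "a k - a k * (real k ^ k / fact k) = - (a k * (real k ^ k / fact k - 1))"
      by (simp add: algebra_simps)
    finally have small: "\<bar>a k\<bar> * \<bar>real k ^ k / fact k - 1\<bar> \<le> 1 / 2"
      by (simp add: abs_mult)
    have "2 \<le> real k ^ k / fact k"
      using double_fact_le_power [of k] less.prems by (simp add: le_divide_eq)
    then have "\<bar>a k\<bar> * 1 \<le> \<bar>a k\<bar> * \<bar>real k ^ k / fact k - 1\<bar>"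
      by (intro mult_left_mono) auto
    with small have "\<bar>a k\<bar> < 1" by simp
    with a_Ints [of k] less.prems show "a k = 0"
      by (auto intro: Ints_nonzero_abs_less1)
  qed
  then show ?thesis
    by (simp add: a_def)
qed

section \<open>Both endpoints, and iterated one-sided derivatives\<close>

lemma vanishing_derivatives_at_1:
  fixes F :: "nat \<Rightarrow> real \<Rightarrow> real" and b :: "nat \<Rightarrow> nat \<Rightarrow> int"
  defines "P \<equiv> \<lambda>n. bernstein_form n (\<lambda>k. of_int (b n k))"
  assumes D: "\<And>i x. i < s \<Longrightarrow> x \<in> {0..1} \<Longrightarrow>
      (F i has_real_derivative F (Suc i) x) (at x within {0..1})"
    and cont: "continuous_on {0..1} (F s)"
    and near: "\<And>n k. n > 0 \<Longrightarrow> k \<le> n \<Longrightarrow>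
      \<bar>of_int (b n k) - F 0 (real k / real n) * real (n choose k)\<bar> \<le> 1 / 2"
    and lim0: "\<And>x. x \<in> {0..1} \<Longrightarrow> (\<lambda>n. poly (P n) x) \<longlonglongrightarrow> F 0 x"
    and lims: "uniform_limit {0..1} (\<lambda>n. poly ((pderiv ^^ s) (P n))) (F s) sequentially"
    and k: "2 \<le> k" "k \<le> s"
  shows "F k 1 = 0"
proof -
  define F' where "F' = (\<lambda>i x. (-1) ^ i * F i (1 - x))"
  define b' where "b' = (\<lambda>n k. b n (n - k))"
  have P': "bernstein_form n (\<lambda>k. of_int (b' n k)) = pcompose (P n) [:1, -1:]" for n
    by (simp add: P_def b'_def bernstein_form_reflect)
  have "F' k 0 = 0"
  proof (rule vanishing_derivatives_at_0 [where F = F' and b = b', OF _ _ _ _ _ k])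
    fix i and x :: real assume i: "i < s" and x: "x \<in> {0..1}"
    have "((\<lambda>x. F i (1 - x)) has_real_derivative - F (Suc i) (1 - x)) (at x within {0..1})"
    proof -
      have "(\<lambda>x::real. 1 - x) ` {0..1} = {0..1}"
        by (auto simp: image_iff intro!: bexI [of _ "1 - _"])
      then have "(F i has_real_derivative F (Suc i) (1 - x)) (at (1 - x) within (\<lambda>x. 1 - x) ` {0..1})"
        using D [OF i, of "1 - x"] x by simp
      moreover have "((\<lambda>x::real. 1 - x) has_real_derivative -1) (at x within {0..1})"
        by (auto intro!: derivative_eq_intros)
      ultimately have "(F i \<circ> (\<lambda>x. 1 - x) has_real_derivative F (Suc i) (1 - x) * (-1)) (at x within {0..1})"
        by (rule DERIV_image_chain)
      then show ?thesis by (simp add: o_def)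
    qed
    from DERIV_cmult [OF this, of "(-1) ^ i"]
    show "(F' i has_real_derivative F' (Suc i) x) (at x within {0..1})"
      by (simp add: F'_def)
  next
    show "continuous_on {0..1} (F' s)"
      unfolding F'_def by (intro continuous_intros continuous_on_compose2 [OF cont]) auto
  next
    fix n k :: nat assume "n > 0" "k \<le> n"
    moreover from this have "1 - real k / real n = real (n - k) / real n"
      by (simp add: field_simps of_nat_diff)
    ultimately show "\<bar>of_int (b' n k) - F' 0 (real k / real n) * real (n choose k)\<bar> \<le> 1 / 2"
      using near [of n "n - k"] by (simp add: F'_def b'_def binomial_symmetric [symmetric])
  next
    fix x :: real assume "x \<in> {0..1}"
    then show "(\<lambda>n. poly (bernstein_form n (\<lambda>k. of_int (b' n k))) x) \<longlonglongrightarrow> F' 0 x"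
      using lim0 [of "1 - x"] by (simp add: P' F'_def poly_pcompose)
  next
    have "uniform_limit {0..1} (\<lambda>n x. poly ((pderiv ^^ s) (P n)) (1 - x)) (\<lambda>x. F s (1 - x)) sequentially"
      using lims by (rule uniform_limit_compose') auto
    then show "uniform_limit {0..1}
        (\<lambda>n. poly ((pderiv ^^ s) (bernstein_form n (\<lambda>k. of_int (b' n k))))) (F' s) sequentially"
      unfolding P' F'_def
      by (simp add: higher_pderiv_reflect poly_pcompose uniform_limit_iff dist_norm abs_mult
          flip: right_diff_distrib)
  qed
  then show ?thesis
    by (simp add: F'_def)
qed

text \<open>Iterated vector derivatives within \<open>[0,1]\<close> are determined by any chain of derivatives on
  \<open>[0,1]\<close>, since at each point of the interval the one-sided derivative is unique.\<close>

lemma deriv01_eqI: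
  assumes "\<And>x. x \<in> {0..1} \<Longrightarrow> f x = F 0 x"
    and D: "\<And>i x. i < s \<Longrightarrow> x \<in> {0..1} \<Longrightarrow>
      (F i has_real_derivative F (Suc i) x) (at x within {0..1})"
    and "i \<le> s" and "x \<in> {0..1}"
  shows "deriv01 i f x = F i x"
  using assms(3,4)
proof (induction i arbitrary: x)
  case 0
  then show ?case by (simp add: deriv01_def assms(1))
next
  case (Suc i)
  have "(F i has_vector_derivative F (Suc i) x) (at x within {0..1})"
    using Suc.prems D by (simp add: has_real_derivative_iff_has_vector_derivative)
  then have "(deriv01 i f has_vector_derivative F (Suc i) x) (at x within {0..1})"
    by (rule has_vector_derivative_transform [rotated 2]) (use Suc in auto)
  then have "vector_derivative (deriv01 i f) (at x within {0..1}) = F (Suc i) x"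
    using Suc.prems by (intro vector_derivative_within_closed_interval) auto
  then show ?case
    by (simp add: deriv01_def)
qed

lemma deriv01_poly:
  assumes "\<And>x. x \<in> {0..1} \<Longrightarrow> f x = poly p x" and "x \<in> {0..1}"
  shows "deriv01 i f x = poly ((pderiv ^^ i) p) x"
  by (rule deriv01_eqI [where s = i and F = "\<lambda>i. poly ((pderiv ^^ i) p)"])
    (use assms in \<open>auto intro: DERIV_subset [OF poly_DERIV]\<close>)

lemma C01_has_derivative:
  assumes "f \<in> C01 s" and "i < s" and "x \<in> {0..1}"
  shows "(deriv01 i f has_real_derivative deriv01 (Suc i) f x) (at x within {0..1})"
proof -
  have "deriv01 i f differentiable (at x within {0..1})"
    using assms by (auto simp: C01_def differentiable_on_def)
  then show ?thesis
    by (simp add: vector_derivative_works has_real_derivative_iff_has_vector_derivative deriv01_def)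
qed

text \<open>Continuity ensures that the supremum is taken over a bounded set and so is an upper bound of
  the pointwise differences.\<close>

lemma uniform_limit_of_supnorm01:
  assumes lim: "(\<lambda>n. supnorm01 (\<lambda>x. g n x - h x)) \<longlonglongrightarrow> 0"
    and cont: "\<And>n. continuous_on {0..1} (g n)" "continuous_on {0..1} h"
  shows "uniform_limit {0..1} g h sequentially"
proof (rule uniform_limitI)
  fix e :: real assume "e > 0"
  have bdd: "bdd_above ((\<lambda>x. \<bar>g n x - h x\<bar>) ` {0..1})" for n
    by (intro bounded_imp_bdd_above compact_imp_bounded compact_continuous_image
        continuous_intros cont) auto
  have "\<forall>\<^sub>F n in sequentially. supnorm01 (\<lambda>x. g n x - h x) < e"
    using lim \<open>e > 0\<close> by (rule order_tendstoD)
  then show "\<forall>\<^sub>F n in sequentially. \<forall>x\<in>{0..1}. dist (g n x) (h x) < e"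
  proof eventually_elim
    case (elim n)
    show ?case
    proof
      fix x :: real assume "x \<in> {0..1}"
      then have "\<bar>g n x - h x\<bar> \<le> supnorm01 (\<lambda>x. g n x - h x)"
        unfolding supnorm01_def by (rule cSUP_upper [OF _ bdd])
      with elim show "dist (g n x) (h x) < e"
        by (simp add: dist_norm)
    qed
  qed
qed

lemma nearest_int_abs_le_half:
  assumes "nearest_int a m"
  shows "\<bar>of_int m - a\<bar> \<le> 1 / 2"
proof -
  have "\<bar>a - of_int m\<bar> \<le> \<bar>a - of_int (round a)\<bar>"
    using assms unfolding nearest_int_def is_arg_min_def by (auto simp: not_less)
  also have "\<dots> \<le> 1 / 2"
    using of_int_round_abs_le [of a] by (simp add: abs_minus_commute)
  finally show ?thesis
    by (simp add: abs_minus_commute)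
qed

theorem theorem3p1:
  fixes s :: nat and f :: "real \<Rightarrow> real" and rnd :: "nat \<Rightarrow> nat \<Rightarrow> real \<Rightarrow> int"
  assumes "s \<ge> 2"
    and "f \<in> C01 s"
    and "tie_breaking_rule rnd"
    and "(\<lambda>n. supnorm01 (\<lambda>x. int_bernstein rnd n f x - f x)) \<longlonglongrightarrow> 0"
    and "(\<lambda>n. supnorm01 (\<lambda>x. deriv01 s (int_bernstein rnd n f) x - deriv01 s f x)) \<longlonglongrightarrow> 0"
  shows "\<forall>i\<in>{2..s}. deriv01 i f 0 = 0 \<and> deriv01 i f 1 = 0"
proof -
  define b where "b = (\<lambda>n k. rnd n k (f (real k / real n) * real (n choose k)))"
  define P where "P = (\<lambda>n. bernstein_form n (\<lambda>k. of_int (b n k)))"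
  define F where "F = (\<lambda>i. deriv01 i f)"
  have F0: "F 0 = f"
    by (simp add: F_def deriv01_def)
  have P: "int_bernstein rnd n f = poly (P n)" for n
    by (auto simp: int_bernstein_def P_def b_def poly_bernstein_form atMost_atLeast0)
  have D: "(F i has_real_derivative F (Suc i) x) (at x within {0..1})"
    if "i < s" "x \<in> {0..1}" for i x
    unfolding F_def using C01_has_derivative [OF assms(2) that] .
  have cont: "continuous_on {0..1} (F s)"
    using assms(2) by (simp add: F_def C01_def)
  have cont0: "continuous_on {0..1} f"
    unfolding continuous_on_eq_continuous_within
    by (intro ballI DERIV_continuous [OF D [of 0, unfolded F0]]) (use assms(1) in auto)
  have near: "\<bar>of_int (b n k) - F 0 (real k / real n) * real (n choose k)\<bar> \<le> 1 / 2" for n k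
    using assms(3) unfolding F0 b_def by (intro nearest_int_abs_le_half) (simp add: tie_breaking_rule_def)
  have "uniform_limit {0..1} (\<lambda>n. poly (P n)) f sequentially"
    using assms(4) cont0 unfolding P by (intro uniform_limit_of_supnorm01) (auto intro!: continuous_intros)
  then have lim0: "(\<lambda>n. poly (P n) x) \<longlonglongrightarrow> F 0 x" if "x \<in> {0..1}" for x
    unfolding F0 using that by (rule tendsto_uniform_limitI)
  have sth: "deriv01 s (poly (P n)) x = poly ((pderiv ^^ s) (P n)) x" if "x \<in> {0..1}" for n x
    using that by (intro deriv01_poly) auto
  have "supnorm01 (\<lambda>x. deriv01 s (poly (P n)) x - F s x)
      = supnorm01 (\<lambda>x. poly ((pderiv ^^ s) (P n)) x - F s x)" for n
    unfolding supnorm01_def by (intro SUP_cong) (auto simp: sth)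
  then have "(\<lambda>n. supnorm01 (\<lambda>x. poly ((pderiv ^^ s) (P n)) x - F s x)) \<longlonglongrightarrow> 0"
    using assms(5) unfolding P F_def by simp
  then have lims: "uniform_limit {0..1} (\<lambda>n. poly ((pderiv ^^ s) (P n))) (F s) sequentially"
    using cont by (intro uniform_limit_of_supnorm01) (auto intro!: continuous_intros)
  show ?thesis
  proof
    fix i assume "i \<in> {2..s}"
    then have i: "2 \<le> i" "i \<le> s" by auto
    have "F i 0 = 0"
      by (rule vanishing_derivatives_at_0 [OF D cont near lim0 [unfolded P_def] lims [unfolded P_def] i])
    moreover have "F i 1 = 0"
      by (rule vanishing_derivatives_at_1 [OF D cont near lim0 [unfolded P_def] lims [unfolded P_def] i])
    ultimately show "deriv01 i f 0 = 0 \<and> deriv01 i f 1 = 0"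
      by (simp add: F_def)
  qed
qed

end
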